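(* Let $\mathcal{P}$ be a finite POMDP with corresponding $0/1$-WA$^z$ $\mathcal{M}^z$, and let $\phi=P_{\unlhd p}[\phi_1\,\mathcal{U}^{\leq k}\phi_2]$ with $\unlhd\in\{\leq,<\}$. The CEGAR procedure described in the context is sound and complete: it terminates after finitely many iterations; if it terminates with an abstraction $\mathcal{M}^z/\varPi$ satisfying $\mathcal{M}^z/\varPi\models\phi$, then $\mathcal{P}\models\phi$; and if it terminates with a non-spurious counterexample, then $\mathcal{P}\not\models\phi$.
   Context: POMDP, $0/1$-WA$^z$ (weighted automaton with per-state observation label $L^z$ and proposition label $L$, weights not required to sum to 1), the corresponding $0/1$-WA$^z$ of a POMDP (states $[s,z]$ plus initial $\bar{s}$, weights $T(s,a,s')O(s',z')$, $L^z([s,z])=z$, $L^z(\bar{s})=init$), observation-based adversaries and satisfaction of $P_{\unlhd p}[\phi_1\,\mathcal{U}^{\leq k}\phi_2]$ (for all observation-based adversaries, the weighted probability of paths satisfying the bounded until is $\unlhd p$) are as usual. Quotient: a partition $\varPi$ of the state set $S$ of $\mathcal{M}^z$ is consistent if any two states in the same block have equal $L^z$ and equal $L$ labels. The quotient $\mathcal{M}^z/\varPi$ has states $\varPi$, initial state $[\bar{s}]_\varPi$, actions $A$, weights $T_\varPi(c,a,c')=\max_{s\in c}\sum_{s'\in c'}T(s,a,s')$, and labels inherited from members. Procedure: start with the coarsest consistent partition $\varPi_0$ (states grouped exactly by equal observation and proposition labels). At iteration $i$, model check $\phi$ on $\mathcal{M}^z/\varPi_i$. If it holds, stop and report $\mathcal{P}\models\phi$.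 Otherwise obtain a counterexample: a finite set $Path_{CE}$ of finite abstract paths $c_0a_0\dots c_n$ whose total weight violates $\unlhd p$. Its realization consists of all concrete paths $s_0a_0\dots s_n$ with $s_j\in c_j$; if the total concrete weight of all realizations violates $\unlhd p$, the counterexample is non-spurious: stop and report $\mathcal{P}\not\models\phi$. Otherwise (spurious), refine: repeatedly split some block of the current partition containing more than one state into two nonempty blocks (keeping consistency) until the previous counterexample no longer has violating weight, obtaining a strictly finer consistent partition $\varPi_{i+1}$, and continue. *)

theory Defs
  imports "HOL-Probability.Probability" "HOL-Library.Disjoint_Sets"
begin

datatype 'p form = Tru | Atom 'p | Neg "'p form" | Conj "'p form" "'p form"

fun sat :: "'p set \<Rightarrow> 'p form \<Rightarrow> bool" where
  "sat l Tru \<longleftrightarrow> True"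
| "sat l (Atom x) \<longleftrightarrow> x \<in> l"
| "sat l (Neg \<phi>) \<longleftrightarrow> \<not> sat l \<phi>"
| "sat l (Conj \<phi> \<psi>) \<longleftrightarrow> sat l \<phi> \<and> sat l \<psi>"

datatype cmp = Leq | Less

fun meets_bound :: "cmp \<Rightarrow> real \<Rightarrow> real \<Rightarrow> bool" where
  "meets_bound Leq x p \<longleftrightarrow> x \<le> p"
| "meets_bound Less x p \<longleftrightarrow> x < p"

datatype 'p bounded_until = Until "'p form" nat "'p form"

datatype 'p pctl = Prob cmp real "'p bounded_until"

fun until_holds :: "'p bounded_until \<Rightarrow> 'p set list \<Rightarrow> bool" where
  "until_holds (Until \<phi>1 k \<phi>2) ls \<longleftrightarrow>
     (\<exists>j < length ls. j \<le> k \<and> sat (ls ! j) \<phi>2 \<and> (\<forall>i < j. sat (ls ! i) \<phi>1))"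

fun horizon :: "'p bounded_until \<Rightarrow> nat" where
  "horizon (Until \<phi>1 k \<phi>2) = k"


record ('s, 'a, 'z, 'p) pomdp =
  p_init :: 's
  p_trans :: "'s \<Rightarrow> 'a \<Rightarrow> 's pmf"
  p_emit :: "'s \<Rightarrow> 'z pmf"
  p_lab :: "'s \<Rightarrow> 'p set"

text \<open>
  A run is the list of its steps (action, successor state, emitted observation); the initial
  state emits nothing. An observation-based adversary sees only the actions and observations.
\<close>

type_synonym ('a, 'z) p_adversary = "('a \<times> 'z) list \<Rightarrow> 'a"

definition p_states :: "('s, 'a, 'z, 'p) pomdp \<Rightarrow> ('a \<times> 's \<times> 'z) list \<Rightarrow> 's list" where
  "p_states P h = p_init P # map (\<lambda>(a, s, z). s) h"

primrec p_run ::
  "('s, 'a, 'z, 'p) pomdp \<Rightarrow> ('a, 'z) p_adversary \<Rightarrow> nat \<Rightarrow> ('a \<times> 's \<times> 'z) list pmf" where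
  "p_run P \<sigma> 0 = return_pmf []"
| "p_run P \<sigma> (Suc n) = do {
     h \<leftarrow> p_run P \<sigma> n;
     let a = \<sigma> (map (\<lambda>(a, s, z). (a, z)) h);
     s \<leftarrow> p_trans P (last (p_states P h)) a;
     z \<leftarrow> p_emit P s;
     return_pmf (h @ [(a, s, z)])
   }"

text \<open>Whether a path satisfies a step-bounded until depends only on its first \<open>horizon\<close> steps.\<close>

definition p_prob :: "('s, 'a, 'z, 'p) pomdp \<Rightarrow> ('a, 'z) p_adversary \<Rightarrow> 'p bounded_until \<Rightarrow> real" where
  "p_prob P \<sigma> \<psi> = measure_pmf.prob (p_run P \<sigma> (horizon \<psi>))
     {h. until_holds \<psi> (map (p_lab P) (p_states P h))}"

fun p_sat :: "('s, 'a, 'z, 'p) pomdp \<Rightarrow> 'p pctl \<Rightarrow> bool" where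
  "p_sat P (Prob c p \<psi>) \<longleftrightarrow> (\<forall>\<sigma>. meets_bound c (p_prob P \<sigma> \<psi>) p)"


record ('s, 'a, 'o, 'p) wa =
  wa_states :: "'s set"
  wa_init :: 's
  wa_weight :: "'s \<Rightarrow> 'a \<Rightarrow> 's \<Rightarrow> real"
  wa_obs :: "'s \<Rightarrow> 'o"
  wa_lab :: "'s \<Rightarrow> 'p set"

text \<open>The path \<open>s\<^sub>0 a\<^sub>0 s\<^sub>1 a\<^sub>1 \<dots> s\<^sub>n\<close> is represented by \<open>(s\<^sub>0, [(a\<^sub>0, s\<^sub>1), (a\<^sub>1, s\<^sub>2), \<dots>])\<close>.\<close>

type_synonym ('s, 'a) path = "'s \<times> ('a \<times> 's) list"

type_synonym ('o, 'a) wa_adversary = "'o \<times> ('a \<times> 'o) list \<Rightarrow> 'a"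

fun is_path :: "('s, 'a, 'o, 'p) wa \<Rightarrow> ('s, 'a) path \<Rightarrow> bool" where
  "is_path M (s, []) \<longleftrightarrow> s \<in> wa_states M"
| "is_path M (s, (a, t) # \<rho>) \<longleftrightarrow>
     s \<in> wa_states M \<and> wa_weight M s a t > 0 \<and> is_path M (t, \<rho>)"

fun path_weight :: "('s, 'a, 'o, 'p) wa \<Rightarrow> ('s, 'a) path \<Rightarrow> real" where
  "path_weight M (s, []) = 1"
| "path_weight M (s, (a, t) # \<rho>) = wa_weight M s a t * path_weight M (t, \<rho>)"

definition total_weight :: "('s, 'a, 'o, 'p) wa \<Rightarrow> ('s, 'a) path set \<Rightarrow> real" where
  "total_weight M C = (\<Sum>\<rho>\<in>C. path_weight M \<rho>)"

fun path_prefix :: "nat \<Rightarrow> ('s, 'a) path \<Rightarrow> ('s, 'a) path" where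
  "path_prefix m (s, \<rho>) = (s, take m \<rho>)"

fun path_trace :: "('s, 'a, 'o, 'p) wa \<Rightarrow> ('s, 'a) path \<Rightarrow> 'o \<times> ('a \<times> 'o) list" where
  "path_trace M (s, \<rho>) = (wa_obs M s, map (\<lambda>(a, t). (a, wa_obs M t)) \<rho>)"

fun path_labels :: "('s, 'a, 'o, 'p) wa \<Rightarrow> ('s, 'a) path \<Rightarrow> 'p set list" where
  "path_labels M (s, \<rho>) = map (wa_lab M) (s # map snd \<rho>)"

definition follows ::
  "('s, 'a, 'o, 'p) wa \<Rightarrow> ('o, 'a) wa_adversary \<Rightarrow> ('s, 'a) path \<Rightarrow> bool" where
  "follows M \<sigma> \<rho> \<longleftrightarrow>
     (\<forall>j < length (snd \<rho>). fst (snd \<rho> ! j) = \<sigma> (path_trace M (path_prefix j \<rho>)))"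

text \<open>
  As the weights leaving a state need not sum to 1, the weight of the set of all paths
  satisfying an until formula is the sum over the minimal finite paths satisfying it; these are
  pairwise prefix-free, so that nothing is counted twice.
\<close>

definition until_paths ::
  "('s, 'a, 'o, 'p) wa \<Rightarrow> ('o, 'a) wa_adversary \<Rightarrow> 'p bounded_until \<Rightarrow> ('s, 'a) path set" where
  "until_paths M \<sigma> \<psi> = {\<rho>. is_path M \<rho> \<and> fst \<rho> = wa_init M \<and> follows M \<sigma> \<rho> \<and>
     until_holds \<psi> (path_labels M \<rho>) \<and>
     (\<forall>m < length (snd \<rho>). \<not> until_holds \<psi> (path_labels M (path_prefix m \<rho>)))}"

fun wa_sat :: "('s, 'a, 'o, 'p) wa \<Rightarrow> 'p pctl \<Rightarrow> bool" where
  "wa_sat M (Prob c p \<psi>) \<longleftrightarrow>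
     (\<forall>\<sigma>. meets_bound c (total_weight M (until_paths M \<sigma> \<psi>)) p)"


text \<open>
  In the automaton of a POMDP, \<open>None\<close> is the initial state, and also its observation
  \<open>init\<close>; \<open>Some (s, z)\<close> is the state written [s,z].
\<close>

fun wa_base :: "('s, 'a, 'z, 'p) pomdp \<Rightarrow> ('s \<times> 'z) option \<Rightarrow> 's" where
  "wa_base P None = p_init P"
| "wa_base P (Some (s, z)) = s"

fun wa_of_weight ::
  "('s, 'a, 'z, 'p) pomdp \<Rightarrow> ('s \<times> 'z) option \<Rightarrow> 'a \<Rightarrow> ('s \<times> 'z) option \<Rightarrow> real" where
  "wa_of_weight P x a None = 0"
| "wa_of_weight P x a (Some (s', z')) =
     pmf (p_trans P (wa_base P x) a) s' * pmf (p_emit P s') z'"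

definition wa_of ::
  "('s, 'a, 'z, 'p) pomdp \<Rightarrow> (('s \<times> 'z) option, 'a, 'z option, 'p) wa" where
  "wa_of P = \<lparr>
     wa_states = UNIV,
     wa_init = None,
     wa_weight = wa_of_weight P,
     wa_obs = map_option snd,
     wa_lab = p_lab P \<circ> wa_base P\<rparr>"


definition consistent :: "('s, 'a, 'o, 'p) wa \<Rightarrow> 's set set \<Rightarrow> bool" where
  "consistent M \<B> \<longleftrightarrow> partition_on (wa_states M) \<B> \<and>
     (\<forall>c\<in>\<B>. \<forall>s\<in>c. \<forall>t\<in>c. wa_obs M s = wa_obs M t \<and> wa_lab M s = wa_lab M t)"

definition coarsest :: "('s, 'a, 'o, 'p) wa \<Rightarrow> 's set set" where
  "coarsest M = wa_states M // {(s, t). s \<in> wa_states M \<and> t \<in> wa_states M \<and>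
     wa_obs M s = wa_obs M t \<and> wa_lab M s = wa_lab M t}"

definition quot :: "('s, 'a, 'o, 'p) wa \<Rightarrow> 's set set \<Rightarrow> ('s set, 'a, 'o, 'p) wa" where
  "quot M \<B> = \<lparr>
     wa_states = \<B>,
     wa_init = (THE c. c \<in> \<B> \<and> wa_init M \<in> c),
     wa_weight = (\<lambda>c a c'. Max ((\<lambda>s. \<Sum>s'\<in>c'. wa_weight M s a s') ` c)),
     wa_obs = (\<lambda>c. the_elem (wa_obs M ` c)),
     wa_lab = (\<lambda>c. the_elem (wa_lab M ` c))\<rparr>"


fun violates :: "'p pctl \<Rightarrow> real \<Rightarrow> bool" where
  "violates (Prob c p \<psi>) w \<longleftrightarrow> \<not> meets_bound c w p"

fun counterexample :: "('s, 'a, 'o, 'p) wa \<Rightarrow> 'p pctl \<Rightarrow> ('s, 'a) path set \<Rightarrow> bool" where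
  "counterexample M (Prob c p \<psi>) C \<longleftrightarrow>
     finite C \<and> (\<exists>\<sigma>. C \<subseteq> until_paths M \<sigma> \<psi>) \<and> violates (Prob c p \<psi>) (total_weight M C)"

definition path_rel :: "('s \<Rightarrow> 't \<Rightarrow> bool) \<Rightarrow> ('s, 'a) path \<Rightarrow> ('t, 'a) path \<Rightarrow> bool" where
  "path_rel R = rel_prod R (list_all2 (rel_prod (=) R))"

definition realization ::
  "('s, 'a, 'o, 'p) wa \<Rightarrow> ('s set, 'a) path set \<Rightarrow> ('s, 'a) path set" where
  "realization M C = {\<rho>. is_path M \<rho> \<and> (\<exists>\<gamma>\<in>C. path_rel (\<in>) \<rho> \<gamma>)}"

text \<open>
  What a set of abstract paths over a coarser partition becomes over the finer partition
  \<open>\<B>\<close>: all paths of the finer quotient running through sub-blocks.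
\<close>

definition refined_paths ::
  "('s, 'a, 'o, 'p) wa \<Rightarrow> 's set set \<Rightarrow> ('s set, 'a) path set \<Rightarrow> ('s set, 'a) path set" where
  "refined_paths M \<B> C = {\<rho>. is_path (quot M \<B>) \<rho> \<and> (\<exists>\<gamma>\<in>C. path_rel (\<subseteq>) \<rho> \<gamma>)}"

definition splits_block :: "'s set set \<Rightarrow> 's set set \<Rightarrow> bool" where
  "splits_block \<B> \<B>' \<longleftrightarrow> (\<exists>c\<in>\<B>. \<exists>c1 c2. c1 \<noteq> {} \<and> c2 \<noteq> {} \<and> c1 \<inter> c2 = {} \<and> c1 \<union> c2 = c \<and>
     \<B>' = (\<B> - {c}) \<union> {c1, c2})"

text \<open>
  \<open>Check \<B>\<close>: start of an iteration with partition \<open>\<B>\<close>. \<open>Refine C \<B>\<close>: inside the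
  splitting loop for the spurious counterexample \<open>C\<close>, whose blocks belong to the partition at
  the start of the loop, with current partition \<open>\<B>\<close>. \<open>Holds\<close> and \<open>Fails\<close>: the two reports.
\<close>

datatype ('s, 'a) config =
    Check "'s set set"
  | Refine "('s set, 'a) path set" "'s set set"
  | Holds "'s set set"
  | Fails "'s set set" "('s set, 'a) path set"

inductive cegar_step ::
  "('s, 'a, 'o, 'p) wa \<Rightarrow> 'p pctl \<Rightarrow> ('s, 'a) config \<Rightarrow> ('s, 'a) config \<Rightarrow> bool"
  for M :: "('s, 'a, 'o, 'p) wa" and \<phi> :: "'p pctl" where
  report_holds:
    "wa_sat (quot M \<B>) \<phi> \<Longrightarrow> cegar_step M \<phi> (Check \<B>) (Holds \<B>)"
| report_fails:
    "\<not> wa_sat (quot M \<B>) \<phi> \<Longrightarrow> counterexample (quot M \<B>) \<phi> C \<Longrightarrow>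
     violates \<phi> (total_weight M (realization M C)) \<Longrightarrow>
     cegar_step M \<phi> (Check \<B>) (Fails \<B> C)"
| spurious:
    "\<not> wa_sat (quot M \<B>) \<phi> \<Longrightarrow> counterexample (quot M \<B>) \<phi> C \<Longrightarrow>
     \<not> violates \<phi> (total_weight M (realization M C)) \<Longrightarrow>
     cegar_step M \<phi> (Check \<B>) (Refine C \<B>)"
| split:
    "violates \<phi> (total_weight (quot M \<B>) (refined_paths M \<B> C)) \<Longrightarrow>
     splits_block \<B> \<B>' \<Longrightarrow> consistent M \<B>' \<Longrightarrow>
     cegar_step M \<phi> (Refine C \<B>) (Refine C \<B>')"
| refined:
    "\<not> violates \<phi> (total_weight (quot M \<B>) (refined_paths M \<B> C)) \<Longrightarrow>
     cegar_step M \<phi> (Refine C \<B>) (Check \<B>)"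

definition cegar_start :: "('s, 'a, 'o, 'p) wa \<Rightarrow> ('s, 'a) config" where
  "cegar_start M = Check (coarsest M)"

definition cegar_reachable ::
  "('s, 'a, 'o, 'p) wa \<Rightarrow> 'p pctl \<Rightarrow> ('s, 'a) config \<Rightarrow> bool" where
  "cegar_reachable M \<phi> x \<longleftrightarrow> (cegar_step M \<phi>)\<^sup>*\<^sup>* (cegar_start M) x"

end

theory Submission
  imports Defs
begin

text \<open>
  The concrete paths through a fixed abstract path have total weight at most that of the abstract
  path, because each quotient weight is a maximum of block sums; hence the quotient
  over-approximates. Conversely, every realization of an abstract counterexample follows the same
  observation-based adversary, as blocks are observation-homogeneous, and starts in the initial
  state, as that state is alone in its block. The POMDP probability equals the weight of the
  automaton since the runs split into the disjoint cylinders of the minimal satisfying prefixes.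
  Each refinement loop must split, because the counterexample still violates the bound over its own
  partition, and it can split, because over the partition into singletons the refined counterexample
  has exactly the weight of its realization.
\<close>

section \<open>Minimal satisfying paths\<close>

lemma until_holds_take_mono:
  assumes "until_holds \<psi> (take m ls)"
  shows "until_holds \<psi> ls"
proof (cases \<psi>)
  case (Until \<phi>1 k \<phi>2)
  with assms obtain j where "j < length (take m ls)" "j \<le> k" "sat (take m ls ! j) \<phi>2"
    "\<forall>i<j. sat (take m ls ! i) \<phi>1"
    by auto
  then show ?thesis
    unfolding Until by (auto intro!: exI[of _ j])
qed

lemma path_labels_prefix:
  "path_labels M (path_prefix m \<rho>) = take (Suc m) (path_labels M \<rho>)"
  by (cases \<rho>) (simp add: take_map)

lemma until_holds_take_horizon:
  assumes "until_holds \<psi> ls"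
  shows "until_holds \<psi> (take (Suc (horizon \<psi>)) ls)"
proof (cases \<psi>)
  case (Until \<phi>1 k \<phi>2)
  with assms obtain j where "j < length ls" "j \<le> k" "sat (ls ! j) \<phi>2" "\<forall>i<j. sat (ls ! i) \<phi>1"
    by auto
  then show ?thesis
    unfolding Until by (auto intro!: exI[of _ j])
qed

text \<open>The until is decided by the first \<open>Suc (horizon \<psi>)\<close> labels, so a
  longer path would have a satisfying proper prefix, against minimality.\<close>

lemma until_paths_length_le:
  assumes "\<rho> \<in> until_paths M \<sigma> \<psi>"
  shows "length (snd \<rho>) \<le> horizon \<psi>"
proof (rule ccontr)
  assume "\<not> ?thesis"
  then have "\<not> until_holds \<psi> (path_labels M (path_prefix (horizon \<psi>) \<rho>))"
    using assms by (simp add: until_paths_def)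
  moreover have "until_holds \<psi> (path_labels M \<rho>)"
    using assms by (simp add: until_paths_def)
  ultimately show False
    unfolding path_labels_prefix using until_holds_take_horizon by blast
qed

lemma finite_until_paths:
  fixes M :: "('s::finite, 'a::finite, 'o, 'p) wa"
  shows "finite (until_paths M \<sigma> \<psi>)"
proof (rule finite_subset)
  show "until_paths M \<sigma> \<psi> \<subseteq> UNIV \<times> {l. set l \<subseteq> UNIV \<and> length l \<le> horizon \<psi>}"
    using until_paths_length_le by fastforce
  show "finite (UNIV \<times> {l. set l \<subseteq> UNIV \<and> length l \<le> horizon \<psi>} :: ('s \<times> ('a \<times> 's) list) set)"
    by (intro finite_cartesian_product finite_lists_length_le) auto
qed

section \<open>Weights, states and fibres of paths\<close>

lemma path_weight_nonneg:
  assumes "\<And>s a t. 0 \<le> wa_weight M s a t"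
  shows "0 \<le> path_weight M (s, l)"
proof (induction l arbitrary: s)
  case (Cons x l)
  then show ?case
    using assms by (cases x) simp
qed simp

lemma path_weight_pos: "is_path M \<rho> \<Longrightarrow> 0 < path_weight M \<rho>"
  by (induction M \<rho> rule: path_weight.induct) auto

lemma path_weight_snoc:
  "path_weight M (s, l @ [(a, t)]) = path_weight M (s, l) * wa_weight M (last (s # map snd l)) a t"
proof (induction l arbitrary: s)
  case (Cons x l)
  then show ?case
    by (cases x) simp
qed simp

lemma path_rel_prefix: "path_rel R (s, l) (c, g) \<Longrightarrow> path_rel R (s, take m l) (c, take m g)"
  by (auto simp: path_rel_def list_all2_takeI)

lemma is_path_states: "is_path M (s, l) \<Longrightarrow> s \<in> wa_states M \<and> snd ` set l \<subseteq> wa_states M"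
proof (induction l arbitrary: s)
  case (Cons x l)
  obtain a d where "x = (a, d)" by fastforce
  with Cons.prems Cons.IH[of d] show ?case
    by auto
qed simp

lemma finite_list_fibre: "finite {l :: ('a::finite \<times> 's::finite) list. list_all2 R l g}"
  by (rule finite_subset[OF _ finite_lists_length_eq[of UNIV "length g"]])
    (auto dest: list_all2_lengthD)

section \<open>The quotient over-approximates the automaton\<close>

lemma is_path_quot_states: "is_path (quot M \<B>) (c, g) \<Longrightarrow> c \<in> \<B> \<and> snd ` set g \<subseteq> \<B>"
proof (induction g arbitrary: c)
  case Nil
  then show ?case by (simp add: quot_def)
next
  case (Cons x g)
  obtain a d where x: "x = (a, d)" by fastforce
  with Cons.prems Cons.IH[of d] show ?case
    by (auto simp: quot_def)
qed

context
  fixes M :: "('s::finite, 'a::finite, 'o, 'p) wa" and \<B> :: "'s set set"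
  assumes cons: "consistent M \<B>"
begin

section \<open>Observations, labels and adversaries under abstraction\<close>

lemma quot_obs: "c \<in> \<B> \<Longrightarrow> s \<in> c \<Longrightarrow> wa_obs (quot M \<B>) c = wa_obs M s"
proof -
  assume "c \<in> \<B>" "s \<in> c"
  with cons have "wa_obs M ` c = {wa_obs M s}"
    unfolding consistent_def by blast
  then show ?thesis
    by (simp add: quot_def)
qed

lemma quot_lab: "c \<in> \<B> \<Longrightarrow> s \<in> c \<Longrightarrow> wa_lab (quot M \<B>) c = wa_lab M s"
proof -
  assume "c \<in> \<B>" "s \<in> c"
  with cons have "wa_lab M ` c = {wa_lab M s}"
    unfolding consistent_def by blast
  then show ?thesis
    by (simp add: quot_def)
qed

lemma block_unique: "c \<in> \<B> \<Longrightarrow> s \<in> c \<Longrightarrow> d \<in> \<B> \<Longrightarrow> s \<in> d \<Longrightarrow> c = d"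
  using cons unfolding consistent_def partition_on_def disjoint_def by blast

text \<open>The same description gives the initial state of \<open>quot\<close>, so
  \<open>wa_init_quot\<close> holds by unfolding.\<close>

definition block :: "'s \<Rightarrow> 's set" where
  "block s = (THE c. c \<in> \<B> \<and> s \<in> c)"

lemma block_eqI: "c \<in> \<B> \<Longrightarrow> s \<in> c \<Longrightarrow> block s = c"
  unfolding block_def by (rule the_equality) (auto dest: block_unique)

lemma
  assumes "s \<in> wa_states M"
  shows block_in: "block s \<in> \<B>" and in_block: "s \<in> block s"
proof -
  obtain c where "c \<in> \<B>" "s \<in> c"
    using cons assms unfolding consistent_def partition_on_def by blast
  with block_eqI show "block s \<in> \<B>" "s \<in> block s"
    by auto
qed

lemma wa_init_quot: "wa_init (quot M \<B>) = block (wa_init M)"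
  by (simp add: quot_def block_def)

text \<open>Blocks are homogeneous, so nothing that an adversary or an until formula reads
  distinguishes a path from its abstraction.\<close>

lemma path_rel_transfer:
  assumes "path_rel (\<in>) (s, l) (c, g)" and "c \<in> \<B>" and "snd ` set g \<subseteq> \<B>"
  shows "path_trace (quot M \<B>) (c, g) = path_trace M (s, l)"
    and "path_labels (quot M \<B>) (c, g) = path_labels M (s, l)"
    and "map fst g = map fst l"
proof -
  have sc: "s \<in> c" and "list_all2 (rel_prod (=) (\<in>)) l g"
    using assms(1) by (auto simp: path_rel_def)
  from this(2) assms(3)
  have "map (\<lambda>(a, t). (a, wa_obs M t)) l = map (\<lambda>(a, t). (a, wa_obs (quot M \<B>) t)) g \<and>
        map (wa_lab M \<circ> snd) l = map (wa_lab (quot M \<B>) \<circ> snd) g \<and> map fst l = map fst g"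
    by (induction rule: list_all2_induct) (auto simp: quot_obs quot_lab)
  with sc assms(2) show "path_trace (quot M \<B>) (c, g) = path_trace M (s, l)"
    "path_labels (quot M \<B>) (c, g) = path_labels M (s, l)" "map fst g = map fst l"
    by (auto simp: quot_obs quot_lab)
qed

text \<open>Adversaries decide on traces of prefixes, and prefixes of related paths are related; one
  and the same \<open>\<sigma>\<close> therefore serves both automata.\<close>

lemma path_rel_follows:
  assumes rel: "path_rel (\<in>) (s, l) (c, g)" and B: "c \<in> \<B>" "snd ` set g \<subseteq> \<B>"
  shows "follows (quot M \<B>) \<sigma> (c, g) \<longleftrightarrow> follows M \<sigma> (s, l)"
proof -
  have fsts: "map fst g = map fst l"
    using path_rel_transfer(3)[OF assms] .
  then have len: "length g = length l"
    by (metis length_map)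
  have "fst (g ! j) = fst (l ! j)" if "j < length l" for j
    using that fsts len by (metis nth_map)
  moreover have "path_trace (quot M \<B>) (c, take j g) = path_trace M (s, take j l)" for j
    using B(2) by (intro path_rel_transfer(1) path_rel_prefix rel B(1)) (auto dest: in_set_takeD)
  ultimately show ?thesis
    unfolding follows_def using len by auto
qed

text \<open>Minimality transfers because lengths and labels agree. The start is a separate
  hypothesis, since in general the initial block may contain further states.\<close>

lemma until_paths_quot_realize:
  assumes "\<gamma> \<in> until_paths (quot M \<B>) \<sigma> \<psi>" and "is_path M \<rho>" and rel: "path_rel (\<in>) \<rho> \<gamma>"
    and "fst \<rho> = wa_init M"
  shows "\<rho> \<in> until_paths M \<sigma> \<psi>"
proof -
  obtain s l c g where eq: "\<rho> = (s, l)" "\<gamma> = (c, g)"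
    by fastforce
  have B: "c \<in> \<B>" "snd ` set g \<subseteq> \<B>"
    using assms(1) is_path_quot_states[of M \<B> c g] unfolding until_paths_def eq by auto
  note rel' = rel[unfolded eq]
  have "length l = length g"
    using path_rel_transfer(3)[OF rel' B] by (metis length_map)
  with assms B path_rel_follows[OF rel' B] path_rel_transfer(2)[OF rel' B] show ?thesis
    unfolding until_paths_def eq path_labels_prefix by auto
qed

section \<open>Comparison of concrete and abstract weights\<close>

context
  assumes nonneg: "\<And>s a t. 0 \<le> wa_weight M s a t"
begin

lemma sum_weight_le_quot_weight:
  "s \<in> c \<Longrightarrow> (\<Sum>t\<in>d. wa_weight M s a t) \<le> wa_weight (quot M \<B>) c a d"
  by (simp add: quot_def)

lemma weight_le_quot_weight:
  assumes "s \<in> c" and "t \<in> d"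
  shows "wa_weight M s a t \<le> wa_weight (quot M \<B>) c a d"
proof -
  have "wa_weight M s a t \<le> (\<Sum>t\<in>d. wa_weight M s a t)"
    using assms nonneg by (intro member_le_sum) auto
  from order_trans[OF this sum_weight_le_quot_weight[OF assms(1)]] show ?thesis .
qed

text \<open>Induction along the abstract suffix with a bound uniform in \<open>s \<in> c\<close>:
  the continuations from all successors share one abstract bound, and the sum over \<open>d\<close>
  that remains is at most the quotient weight.\<close>

lemma fibre_weight_le:
  assumes "s \<in> c"
  shows "(\<Sum>l | list_all2 (rel_prod (=) (\<in>)) l g. path_weight M (s, l))
    \<le> path_weight (quot M \<B>) (c, g)"
  using assms
proof (induction g arbitrary: s c)
  case Nil
  then show ?case by simp
next
  case (Cons x g)
  obtain a d where x: "x = (a, d)" by fastforce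
  let ?F = "{l. list_all2 (rel_prod (=) (\<in>)) l g}"
  let ?q = "path_weight (quot M \<B>)"
  show ?case
  \<comment> \<open>\<open>g\<close> may contain empty sets. Then the fibre is empty and the
    abstract step weighs a maximum of zeros; otherwise a member of \<open>d\<close> serves to show
    that the abstract suffix has nonnegative weight.\<close>
  proof (cases "d = {}")
    case True
    have "{l. list_all2 (rel_prod (=) (\<in>)) l (x # g)} = {}"
      by (auto simp: x True list_all2_Cons2)
    moreover have "?q (c, x # g) = 0"
      using Cons.prems by (auto simp: x True quot_def image_constant_conv)
    ultimately show ?thesis by simp
  next
    case False
    then obtain t0 where t0: "t0 \<in> d" by blast
    have "0 \<le> (\<Sum>l\<in>?F. path_weight M (t0, l))"
      by (intro sum_nonneg path_weight_nonneg nonneg)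
    with Cons.IH[OF t0] have q0: "0 \<le> ?q (d, g)"
      by linarith
    have fib: "{l. list_all2 (rel_prod (=) (\<in>)) l (x # g)} = (\<lambda>(t, l). (a, t) # l) ` (d \<times> ?F)"
      by (auto simp: x list_all2_Cons2 image_iff)
    have "(\<Sum>l | list_all2 (rel_prod (=) (\<in>)) l (x # g). path_weight M (s, l))
        = (\<Sum>(t, l)\<in>d \<times> ?F. wa_weight M s a t * path_weight M (t, l))"
      unfolding fib by (subst sum.reindex) (auto simp: inj_on_def intro!: sum.cong)
    also have "\<dots> = (\<Sum>t\<in>d. wa_weight M s a t * (\<Sum>l\<in>?F. path_weight M (t, l)))"
      by (simp add: sum.cartesian_product[symmetric] sum_distrib_left)
    also have "\<dots> \<le> (\<Sum>t\<in>d. wa_weight M s a t * ?q (d, g))"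
      by (intro sum_mono mult_left_mono nonneg Cons.IH)
    also have "\<dots> = (\<Sum>t\<in>d. wa_weight M s a t) * ?q (d, g)"
      by (simp add: sum_distrib_right)
    also have "\<dots> \<le> ?q (c, x # g)"
      using q0 sum_weight_le_quot_weight[OF Cons.prems] by (simp add: x mult_right_mono)
    finally show ?thesis .
  qed
qed

definition abstract_path :: "('s, 'a) path \<Rightarrow> ('s set, 'a) path" where
  "abstract_path = map_prod block (map (map_prod id block))"

lemma path_rel_abstract_path:
  assumes "is_path M \<rho>"
  shows "path_rel (\<in>) \<rho> (abstract_path \<rho>)"
proof -
  obtain s l where \<rho>: "\<rho> = (s, l)" by fastforce
  with assms have "s \<in> wa_states M" "snd ` set l \<subseteq> wa_states M"
    using is_path_states[of M s l] by auto
  then show ?thesis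
    unfolding \<rho> path_rel_def abstract_path_def
    by (auto simp: list_all2_map2 in_block rel_prod_conv intro!: list.rel_refl_strong)
qed

text \<open>A positive step stays positive, as its weight is one summand of a block sum below the
  quotient weight.\<close>

lemma is_path_abstract_path: "is_path M (s, l) \<Longrightarrow> is_path (quot M \<B>) (abstract_path (s, l))"
proof (induction l arbitrary: s)
  case Nil
  then show ?case
    by (simp add: abstract_path_def quot_def block_in)
next
  case (Cons x l)
  obtain a t where x: "x = (a, t)" by fastforce
  from Cons.prems have s: "s \<in> wa_states M" and w: "0 < wa_weight M s a t" and p: "is_path M (t, l)"
    by (auto simp: x)
  have "t \<in> wa_states M"
    using is_path_states[OF p] by simp
  then have "0 < wa_weight (quot M \<B>) (block s) a (block t)"
    using w weight_le_quot_weight[OF in_block[OF s] in_block, of t a] by simp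
  moreover have "block s \<in> wa_states (quot M \<B>)"
    using s by (simp add: quot_def block_in)
  ultimately show ?case
    using Cons.IH[OF p] by (simp add: abstract_path_def x)
qed

lemma abstract_path_until_paths:
  assumes "\<rho> \<in> until_paths M \<sigma> \<psi>"
  shows "abstract_path \<rho> \<in> until_paths (quot M \<B>) \<sigma> \<psi>"
proof -
  obtain s l where \<rho>: "\<rho> = (s, l)" by fastforce
  obtain c g where g: "abstract_path \<rho> = (c, g)" by fastforce
  have path: "is_path M (s, l)"
    using assms by (auto simp: until_paths_def \<rho>)
  have abs: "is_path (quot M \<B>) (c, g)"
    using is_path_abstract_path[OF path] g \<rho> by simp
  note B = conjunct1[OF is_path_quot_states[OF this]] conjunct2[OF is_path_quot_states[OF this]]
  have rel: "path_rel (\<in>) (s, l) (c, g)"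
    using path_rel_abstract_path[OF path] g \<rho> by simp
  have len: "length l = length g"
    using path_rel_transfer(3)[OF rel B] by (metis length_map)
  have "c = block s"
    using g by (simp add: \<rho> abstract_path_def)
  with assms abs len path_rel_follows[OF rel B] path_rel_transfer(2)[OF rel B] show ?thesis
    unfolding until_paths_def g path_labels_prefix by (auto simp: \<rho> wa_init_quot)
qed

text \<open>Concrete paths are grouped by their abstraction, under the same adversary. Each group
  lies in the fibre over one abstract path, where \<open>fibre_weight_le\<close> applies.\<close>

lemma total_weight_le_quot:
  "total_weight M (until_paths M \<sigma> \<psi>)
    \<le> total_weight (quot M \<B>) (until_paths (quot M \<B>) \<sigma> \<psi>)"
proof -
  let ?U = "until_paths M \<sigma> \<psi>" and ?V = "until_paths (quot M \<B>) \<sigma> \<psi>"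
  have fin: "finite ?U" "finite ?V"
    by (rule finite_until_paths)+
  have "total_weight M ?U = (\<Sum>\<gamma>\<in>?V. \<Sum>\<rho> | \<rho> \<in> ?U \<and> abstract_path \<rho> = \<gamma>. path_weight M \<rho>)"
    unfolding total_weight_def using fin abstract_path_until_paths
    by (intro sum.group[symmetric]) auto
  also have "\<dots> \<le> (\<Sum>\<gamma>\<in>?V. path_weight (quot M \<B>) \<gamma>)"
  proof (rule sum_mono)
    fix \<gamma> assume \<gamma>: "\<gamma> \<in> ?V"
    obtain c g where g: "\<gamma> = (c, g)" by fastforce
    let ?F = "{l. list_all2 (rel_prod (=) (\<in>)) l g}" and ?s = "wa_init M"
    show "(\<Sum>\<rho> | \<rho> \<in> ?U \<and> abstract_path \<rho> = \<gamma>. path_weight M \<rho>) \<le> path_weight (quot M \<B>) \<gamma>"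
    proof (cases "{\<rho> \<in> ?U. abstract_path \<rho> = \<gamma>} = {}")
      case True
      \<comment> \<open>An abstract path without concrete preimage only has to be nonnegative, which
        its positive steps ensure.\<close>
      have "0 \<le> path_weight (quot M \<B>) \<gamma>"
        using \<gamma> by (intro less_imp_le path_weight_pos) (simp add: until_paths_def)
      with True show ?thesis by (simp only: sum.empty)
    next
      case False
      have sub: "?s \<in> c \<and> \<rho> \<in> Pair ?s ` ?F" if "\<rho> \<in> ?U" "abstract_path \<rho> = \<gamma>" for \<rho>
      proof -
        obtain s l where \<rho>: "\<rho> = (s, l)" by fastforce
        have "s = ?s" "path_rel (\<in>) \<rho> \<gamma>"
          using that path_rel_abstract_path by (auto simp: until_paths_def \<rho>)
        then show ?thesis
          by (auto simp: path_rel_def \<rho> g)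
      qed
      with False have s: "?s \<in> c" by blast
      have "(\<Sum>\<rho> | \<rho> \<in> ?U \<and> abstract_path \<rho> = \<gamma>. path_weight M \<rho>)
          \<le> (\<Sum>\<rho>\<in>Pair ?s ` ?F. path_weight M \<rho>)"
        using sub by (intro sum_mono2) (auto intro: finite_list_fibre path_weight_nonneg nonneg)
      also have "\<dots> = (\<Sum>l\<in>?F. path_weight M (?s, l))"
        by (subst sum.reindex) (auto simp: inj_on_def)
      also have "\<dots> \<le> path_weight (quot M \<B>) \<gamma>"
        unfolding g by (rule fibre_weight_le[OF s])
      finally show ?thesis .
    qed
  qed
  finally show ?thesis
    by (simp add: total_weight_def)
qed

end

end

section \<open>The automaton of a POMDP\<close>

definition run_path :: "('a \<times> 's \<times> 'z) list \<Rightarrow> (('s \<times> 'z) option, 'a) path" where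
  "run_path h = (None, map (\<lambda>(a, s, z). (a, Some (s, z))) h)"

text \<open>Traces of runs start with \<open>None\<close> and continue with \<open>Some\<close>;
  only the values on such traces are kept.\<close>

definition run_adversary :: "('z option, 'a) wa_adversary \<Rightarrow> ('a, 'z) p_adversary" where
  "run_adversary \<sigma> h = \<sigma> (None, map (\<lambda>(a, z). (a, Some z)) h)"

text \<open>Lets quantification over POMDP adversaries be replaced by one over automaton
  adversaries. The witness drops the initial observation and strips \<open>Some\<close>.\<close>

lemma surj_run_adversary: "\<exists>\<sigma>. run_adversary \<sigma> = \<tau>"
proof
  show "run_adversary (\<lambda>(_, l). \<tau> (map (\<lambda>(a, x). (a, the x)) l)) = \<tau>"
    by (auto simp: run_adversary_def fun_eq_iff o_def case_prod_beta)
qed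

lemma inj_run_path: "inj run_path"
proof (rule injI)
  fix h h' :: "('a \<times> 's \<times> 'z) list"
  assume eq: "run_path h = run_path h'"
  have "inj (\<lambda>(a :: 'a, s :: 's, z :: 'z). (a, Some (s, z)))"
    by (auto simp: inj_def)
  from inj_mapI[OF this] eq show "h = h'"
    by (auto simp: run_path_def dest: injD)
qed

lemma wa_of_weight_nonneg: "0 \<le> wa_weight (wa_of P) x a y"
  by (cases "(P, x, a, y)" rule: wa_of_weight.cases) (auto simp: wa_of_def)

lemma path_labels_run_path: "path_labels (wa_of P) (run_path h) = map (p_lab P) (p_states P h)"
  by (auto simp: run_path_def wa_of_def p_states_def)

lemma path_prefix_run_path: "path_prefix m (run_path h) = run_path (take m h)"
  by (simp add: run_path_def take_map)

lemma length_run_path: "length (snd (run_path h)) = length h"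
  by (simp add: run_path_def)

lemma path_trace_run_path:
  "path_trace (wa_of P) (run_path h) =
    (None, map (\<lambda>(a, z). (a, Some z)) (map (\<lambda>(a, s, z). (a, z)) h))"
  by (auto simp: run_path_def wa_of_def)

lemma follows_snoc:
  "follows M \<sigma> (s, l @ [(a, t)]) \<longleftrightarrow> follows M \<sigma> (s, l) \<and> a = \<sigma> (path_trace M (s, l))"
  by (auto simp: follows_def nth_append less_Suc_eq)

lemma follows_run_path_snoc:
  "follows (wa_of P) \<sigma> (run_path (h @ [(a, s, z)])) \<longleftrightarrow> follows (wa_of P) \<sigma> (run_path h) \<and>
    a = run_adversary \<sigma> (map (\<lambda>(a, s, z). (a, z)) h)"
  using path_trace_run_path[of P h] unfolding run_adversary_def
  by (simp add: run_path_def follows_snoc del: path_trace.simps)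

lemma wa_base_last_run_path:
  "wa_base P (last (None # map snd (snd (run_path h)))) = last (p_states P h)"
  by (cases h rule: rev_cases) (auto simp: run_path_def p_states_def)

lemma path_weight_run_path_snoc:
  "path_weight (wa_of P) (run_path (h @ [(a, s, z)])) =
    path_weight (wa_of P) (run_path h) * (pmf (p_trans P (last (p_states P h)) a) s * pmf (p_emit P s) z)"
proof -
  have "wa_weight (wa_of P) x a (Some (s, z)) = pmf (p_trans P (wa_base P x) a) s * pmf (p_emit P s) z"
    for x
    by (simp add: wa_of_def)
  with wa_base_last_run_path[of P h] show ?thesis
    by (simp add: run_path_def path_weight_snoc del: last.simps)
qed

section \<open>Distribution of runs and its marginals\<close>

lemma p_run_length: "h \<in> set_pmf (p_run P \<sigma> n) \<Longrightarrow> length h = n"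
  by (induction n arbitrary: h) (auto simp: Let_def)

text \<open>Extending a run only appends a step, so truncation recovers the shorter distribution.
  This later turns the probability of a cylinder into a point mass.\<close>

lemma p_run_take:
  assumes "m \<le> n"
  shows "map_pmf (take m) (p_run P \<sigma> n) = p_run P \<sigma> m"
  using assms
proof (induction n)
  case 0
  then show ?case by simp
next
  case (Suc n)
  show ?case
  proof (cases "m = Suc n")
    case True
    have "map_pmf (take m) (p_run P \<sigma> (Suc n)) = map_pmf id (p_run P \<sigma> (Suc n))"
      by (intro map_pmf_cong refl) (metis True id_apply order_refl p_run_length take_all)
    then show ?thesis
      by (simp only: True pmf.map_id)
  next
    case False
    with Suc.prems have m: "m \<le> n" by simp
    have "map_pmf (take m) (p_run P \<sigma> (Suc n)) =
        bind_pmf (p_run P \<sigma> n) (\<lambda>h. return_pmf (take m h))"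
      using m by (auto simp: Let_def map_bind_pmf intro!: bind_pmf_cong dest!: p_run_length)
    also have "\<dots> = p_run P \<sigma> m"
      using Suc.IH[OF m] by (simp add: map_pmf_def)
    finally show ?thesis .
  qed
qed

lemma pmf_p_run_snoc:
  "pmf (p_run P \<tau> (Suc n)) (h @ [(a, s, z)]) = pmf (p_run P \<tau> n) h *
    (if a = \<tau> (map (\<lambda>(a, s, z). (a, z)) h)
     then pmf (p_trans P (last (p_states P h)) a) s * pmf (p_emit P s) z else 0)"
    (is "_ = _ * ?w")
proof -
  let ?a = "\<lambda>h. \<tau> (map (\<lambda>(a, s, z). (a, z)) h)"
  \<comment> \<open>\<open>K h\<close> is the joint law of the next action, state and observation
    after \<open>h\<close>; the action is a point mass because the adversary is
    deterministic.\<close>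
  define K where "K h = pair_pmf (return_pmf (?a h)) (bind_pmf (p_trans P (last (p_states P h)) (?a h))
    (\<lambda>s. map_pmf (Pair s) (p_emit P s)))" for h
  have run: "p_run P \<tau> (Suc n) = bind_pmf (p_run P \<tau> n) (\<lambda>h. map_pmf (\<lambda>x. h @ [x]) (K h))"
    by (simp add: K_def Let_def pair_pmf_def map_pmf_def bind_assoc_pmf bind_return_pmf)
  have K: "pmf (K h) (a, s, z) = ?w"
  proof -
    have "pmf (map_pmf (Pair s') (p_emit P s')) (s, z) = indicator {s} s' * pmf (p_emit P s) z" for s'
      by (cases "s' = s") (auto simp: pmf_map_inj' inj_def pmf_eq_0_set_pmf)
    then show ?thesis
      by (auto simp: K_def pmf_pair pmf_bind measure_pmf_single)
  qed
  \<comment> \<open>Only \<open>h' = h\<close> can be extended to the given run, so the integral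
    over the previous run collapses to one point.\<close>
  have "pmf (map_pmf (\<lambda>x. h' @ [x]) (K h')) (h @ [(a, s, z)]) = indicator {h} h' * ?w" for h'
  proof (cases "h' = h")
    case True
    have "inj (\<lambda>x. h @ [x])" by (simp add: inj_def)
    from pmf_map_inj'[OF this, of "K h" "(a, s, z)"] True show ?thesis by (simp add: K)
  qed (auto simp: pmf_eq_0_set_pmf)
  then show ?thesis
    by (simp only: run pmf_bind) (simp add: measure_pmf_single)
qed

text \<open>Each step multiplies both sides by the same transition and emission probabilities, or
  makes both 0 if its action deviates from the adversary.\<close>

lemma pmf_p_run:
  "pmf (p_run P (run_adversary \<sigma>) (length h)) h =
    (if follows (wa_of P) \<sigma> (run_path h) then path_weight (wa_of P) (run_path h) else 0)"
proof (induction h rule: rev_induct)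
  case Nil
  then show ?case by (simp add: run_path_def follows_def)
next
  case (snoc x h)
  obtain a s z where x: "x = (a, s, z)" by (cases x)
  show ?case
    using snoc.IH pmf_p_run_snoc[of P "run_adversary \<sigma>" "length h" h a s z]
    by (simp add: x follows_run_path_snoc path_weight_run_path_snoc del: p_run.simps)
qed

section \<open>Paths of the automaton as cylinders of runs\<close>

lemma is_path_wa_of_iff: "is_path (wa_of P) (x, l) \<longleftrightarrow> path_weight (wa_of P) (x, l) \<noteq> 0"
proof (induction l arbitrary: x)
  case Nil
  then show ?case by (simp add: wa_of_def)
next
  case (Cons y l)
  obtain a t where y: "y = (a, t)" by fastforce
  have "wa_states (wa_of P) = UNIV"
    by (simp add: wa_of_def)
  then show ?case
    using Cons.IH[of t] wa_of_weight_nonneg[of P x a t] by (auto simp: y)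
qed

lemma is_path_wa_of_Some:
  assumes "is_path (wa_of P) (x, l)"
  shows "None \<notin> snd ` set l"
  using assms
proof (induction l arbitrary: x)
  case (Cons y l)
  obtain a t where y: "y = (a, t)" by fastforce
  from Cons show ?case
    by (cases t) (auto simp: y wa_of_def)
qed simp

text \<open>Steps into \<open>None\<close> weigh 0, so all states after the first are
  \<open>Some\<close> and \<open>the\<close> recovers the run.\<close>

lemma until_paths_wa_of_range:
  assumes "\<rho> \<in> until_paths (wa_of P) \<sigma> \<psi>"
  shows "\<rho> \<in> range run_path"
proof -
  obtain x l where \<rho>: "\<rho> = (x, l)" by fastforce
  with assms have x: "x = None" and "is_path (wa_of P) (x, l)"
    by (auto simp: until_paths_def wa_of_def)
  from is_path_wa_of_Some[OF this(2)]
  have "map (\<lambda>(a, s, z). (a, Some (s, z))) (map (\<lambda>(a, t). (a, the t)) l) = l"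
    unfolding map_map by (intro map_idI) (auto simp: image_iff)
  then have "run_path (map (\<lambda>(a, t). (a, the t)) l) = \<rho>"
    unfolding run_path_def \<rho> x by simp
  then show ?thesis by blast
qed

text \<open>Up to runs of probability 0, the until event is the union of the cylinders over the runs
  in \<open>H\<close>. These are disjoint, and each has the weight of its minimal path as
  probability.\<close>

lemma p_prob_eq_total_weight:
  fixes P :: "('s::finite, 'a::finite, 'z::finite, 'p) pomdp"
  shows "p_prob P (run_adversary \<sigma>) \<psi> = total_weight (wa_of P) (until_paths (wa_of P) \<sigma> \<psi>)"
proof -
  let ?M = "wa_of P" and ?\<tau> = "run_adversary \<sigma>" and ?n = "horizon \<psi>"
  let ?U = "until_paths ?M \<sigma> \<psi>"
  let ?lab = "\<lambda>h. map (p_lab P) (p_states P h)"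
  define H where "H = run_path -` ?U"
  have lab_take: "?lab (take m h) = take (Suc m) (?lab h)" for m h
    by (simp add: p_states_def take_map)
  have H: "h \<in> H \<longleftrightarrow> is_path ?M (run_path h) \<and> follows ?M \<sigma> (run_path h) \<and>
      until_holds \<psi> (?lab h) \<and> (\<forall>m<length h. \<not> until_holds \<psi> (?lab (take m h)))" for h
    unfolding H_def until_paths_def
    by (simp add: path_labels_run_path path_prefix_run_path length_run_path del: path_labels.simps)
      (simp add: run_path_def wa_of_def)
  have U: "?U = run_path ` H"
    unfolding H_def using until_paths_wa_of_range by (auto simp: image_vimage_eq)
  have finH: "finite H"
    unfolding H_def using finite_until_paths inj_run_path by (intro finite_vimageI)
  have len: "length h \<le> ?n" if "h \<in> H" for h
    using that until_paths_length_le[of "run_path h" ?M \<sigma> \<psi>] by (simp add: H_def length_run_path)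
  \<comment> \<open>The cylinder over \<open>\<rho>\<close>; the equation also forces
    \<open>h\<close> to be at least as long as \<open>\<rho>\<close>.\<close>
  define E where "E \<rho> = {h. take (length \<rho>) h = \<rho>}" for \<rho> :: "('a \<times> 's \<times> 'z) list"
  have "disjoint_family_on E H"
    unfolding disjoint_family_on_def
  proof (intro ballI impI)
    fix \<rho> \<rho>' assume *: "\<rho> \<in> H" "\<rho>' \<in> H" "\<rho> \<noteq> \<rho>'"
    have False if h: "take (length \<rho>) h = \<rho>" "take (length \<rho>') h = \<rho>'" for h
    proof -
      \<comment> \<open>Otherwise \<open>\<rho>\<close> is a proper prefix of \<open>\<rho>'\<close>
        that already satisfies the until, against the minimality of \<open>\<rho>'\<close>.\<close>
      have "\<not> length \<rho> < length \<rho>'"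
      proof
        assume less: "length \<rho> < length \<rho>'"
        then have "take (length \<rho>) \<rho>' = \<rho>"
          using h by (metis less_imp_le_nat min.absorb1 take_take)
        with less * show False by (metis H)
      qed
      moreover have "\<not> length \<rho>' < length \<rho>"
      proof
        assume less: "length \<rho>' < length \<rho>"
        then have "take (length \<rho>') \<rho> = \<rho>'"
          using h by (metis less_imp_le_nat min.absorb1 take_take)
        with less * show False by (metis H)
      qed
      ultimately show False
        using h *(3) by (metis linorder_neqE_nat)
    qed
    then show "E \<rho> \<inter> E \<rho>' = {}"
      by (auto simp: E_def)
  qed
  moreover have "p_prob P ?\<tau> \<psi> = measure_pmf.prob (p_run P ?\<tau> ?n) (\<Union>\<rho>\<in>H. E \<rho>)"
    unfolding p_prob_def
  proof (rule measure_prob_cong_0)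
    fix h assume h: "h \<in> {h. until_holds \<psi> (?lab h)} - (\<Union>\<rho>\<in>H. E \<rho>)"
    show "pmf (p_run P ?\<tau> ?n) h = 0"
    proof (rule ccontr)
      assume "pmf (p_run P ?\<tau> ?n) h \<noteq> 0"
      then have supp: "h \<in> set_pmf (p_run P ?\<tau> ?n)"
        by (simp add: set_pmf_iff)
      \<comment> \<open>The shortest satisfying prefix of \<open>h\<close> selects the cylinder; it
        exists because \<open>h\<close> itself satisfies the until.\<close>
      define m where "m = (LEAST m. until_holds \<psi> (?lab (take m h)))"
      have "until_holds \<psi> (?lab (take (length h) h))"
        using h by simp
      then have m: "until_holds \<psi> (?lab (take m h))" "m \<le> length h"
        unfolding m_def by (rule LeastI, rule Least_le)
      have len_m: "length (take m h) = m" "m \<le> ?n"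
        using m(2) p_run_length[OF supp] by auto
      \<comment> \<open>The prefix has positive probability as a run of length \<open>m\<close>, so
        by \<open>pmf_p_run\<close> it follows \<open>\<sigma>\<close> and has nonzero weight, as
        membership in \<open>H\<close> requires.\<close>
      have "take m h \<in> set_pmf (p_run P ?\<tau> m)"
        using supp p_run_take[OF len_m(2), of P ?\<tau>] by (metis imageI set_map_pmf)
      then have "pmf (p_run P ?\<tau> (length (take m h))) (take m h) \<noteq> 0"
        by (simp only: len_m set_pmf_iff not_False_eq_True)
      then have "follows ?M \<sigma> (run_path (take m h))" "path_weight ?M (run_path (take m h)) \<noteq> 0"
        by (auto simp only: pmf_p_run split: if_splits)
      moreover have "\<not> until_holds \<psi> (?lab (take i (take m h)))" if "i < m" for i
        using that not_less_Least[of i "\<lambda>m. until_holds \<psi> (?lab (take m h))"]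
        by (simp add: m_def[symmetric] min_absorb1)
      ultimately have "take m h \<in> H"
        using m(1) len_m(1) by (simp only: H) (simp add: run_path_def is_path_wa_of_iff)
      moreover have "h \<in> E (take m h)"
        unfolding E_def len_m(1) by simp
      ultimately show False
        using h by blast
    qed
  next
    fix h assume h: "h \<in> (\<Union>\<rho>\<in>H. E \<rho>) - {h. until_holds \<psi> (?lab h)}"
    then obtain \<rho> where "\<rho> \<in> H" "take (length \<rho>) h = \<rho>"
      by (auto simp: E_def)
    then have "until_holds \<psi> (take (Suc (length \<rho>)) (?lab h))"
      by (metis H lab_take)
    with h show "pmf (p_run P ?\<tau> ?n) h = 0"
      using until_holds_take_mono by blast
  qed
  ultimately have "p_prob P ?\<tau> \<psi> = (\<Sum>\<rho>\<in>H. measure_pmf.prob (p_run P ?\<tau> ?n) (E \<rho>))"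
    using finH by (simp add: measure_pmf.finite_measure_finite_Union)
  also have "\<dots> = (\<Sum>\<rho>\<in>H. path_weight ?M (run_path \<rho>))"
  proof (rule sum.cong[OF refl])
    fix \<rho> assume \<rho>: "\<rho> \<in> H"
    \<comment> \<open>As the preimage of a single run under truncation, the cylinder is measured by
      \<open>p_run_take\<close>.\<close>
    have "E \<rho> = take (length \<rho>) -` {\<rho>}"
      by (auto simp: E_def)
    then have "measure_pmf.prob (p_run P ?\<tau> ?n) (E \<rho>) =
        measure_pmf.prob (map_pmf (take (length \<rho>)) (p_run P ?\<tau> ?n)) {\<rho>}"
      by simp
    also have "\<dots> = path_weight ?M (run_path \<rho>)"
      using \<rho> H len[OF \<rho>] by (simp add: p_run_take measure_pmf_single pmf_p_run)
    finally show "measure_pmf.prob (p_run P ?\<tau> ?n) (E \<rho>) = path_weight ?M (run_path \<rho>)" .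
  qed
  also have "\<dots> = total_weight ?M ?U"
    unfolding total_weight_def U
    by (subst sum.reindex) (auto intro: inj_on_subset[OF inj_run_path])
  finally show ?thesis .
qed

lemma p_sat_iff_wa_sat:
  fixes P :: "('s::finite, 'a::finite, 'z::finite, 'p) pomdp"
  shows "p_sat P \<phi> \<longleftrightarrow> wa_sat (wa_of P) \<phi>"
proof (cases \<phi>)
  case (Prob c p \<psi>)
  show ?thesis
    unfolding Prob by simp (metis p_prob_eq_total_weight surj_run_adversary)
qed

section \<open>Termination, progress and the reports\<close>

lemma consistent_coarsest: "consistent M (coarsest M)"
proof -
  let ?r = "{(s, t). s \<in> wa_states M \<and> t \<in> wa_states M \<and>
     wa_obs M s = wa_obs M t \<and> wa_lab M s = wa_lab M t}"
  have "equiv (wa_states M) ?r"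
    by (auto simp: equiv_def refl_on_def sym_def trans_def)
  then have "partition_on (wa_states M) (coarsest M)"
    unfolding coarsest_def by (rule partition_on_quotient)
  then show ?thesis
    unfolding consistent_def by (auto simp: coarsest_def elim!: quotientE)
qed

text \<open>Sending a state to its block maps onto the partition. The bound limits the number of
  splits.\<close>

lemma card_partition_le:
  fixes \<B> :: "'s::finite set set"
  assumes "partition_on A \<B>"
  shows "card \<B> \<le> CARD('s)"
proof -
  have "\<B> \<subseteq> range (\<lambda>s. THE c. c \<in> \<B> \<and> s \<in> c)"
  proof
    fix c assume c: "c \<in> \<B>"
    then obtain s where s: "s \<in> c"
      using assms unfolding partition_on_def by fastforce
    have "(THE c. c \<in> \<B> \<and> s \<in> c) = c"
      using assms c s by (intro the_equality) (auto simp: partition_on_def disjoint_def)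
    then show "c \<in> range (\<lambda>s. THE c. c \<in> \<B> \<and> s \<in> c)"
      by (intro range_eqI[of _ _ s]) simp
  qed
  then have "card \<B> \<le> card (range (\<lambda>s. THE c. c \<in> \<B> \<and> s \<in> c))"
    by (intro card_mono) auto
  also have "\<dots> \<le> CARD('s)"
    by (intro card_image_le) auto
  finally show ?thesis .
qed

lemma card_splits_block:
  fixes \<B> :: "'s::finite set set"
  assumes "splits_block \<B> \<B>'" and "partition_on A \<B>"
  shows "card \<B>' = Suc (card \<B>)"
proof -
  obtain c c1 c2 where c: "c \<in> \<B>" "c1 \<noteq> {}" "c2 \<noteq> {}" "c1 \<inter> c2 = {}" "c1 \<union> c2 = c"
    and B': "\<B>' = (\<B> - {c}) \<union> {c1, c2}"
    using assms(1) unfolding splits_block_def by blast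
  \<comment> \<open>A nonempty part of \<open>c\<close> meets \<open>c\<close> and so is no other
    block: one block is lost and two new ones are gained.\<close>
  have notin: "d \<notin> \<B> - {c}" if "d \<subseteq> c" "d \<noteq> {}" for d
    using assms(2) that c(1) unfolding partition_on_def disjoint_def by blast
  have "c1 \<notin> \<B> - {c}" "c2 \<notin> \<B> - {c}" "c1 \<noteq> c2"
    using notin c by auto
  then have "card \<B>' = card (\<B> - {c}) + 2"
    unfolding B' by (simp add: Un_insert_right)
  moreover have "0 < card \<B>"
    using c(1) by (auto simp: card_gt_0_iff)
  ultimately show ?thesis
    using c(1) by (simp add: card_Diff_singleton)
qed

text \<open>Detaching a single state suffices; the new blocks lie inside old ones and stay
  homogeneous.\<close>

lemma exists_split:
  assumes cons: "consistent M \<B>" and c: "c \<in> \<B>" and "\<nexists>s. c = {s}"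
  shows "\<exists>\<B>'. splits_block \<B> \<B>' \<and> consistent M \<B>'"
proof -
  have part: "partition_on (wa_states M) \<B>"
    using cons by (simp add: consistent_def)
  with c obtain s where s: "s \<in> c"
    unfolding partition_on_def by fastforce
  let ?B' = "(\<B> - {c}) \<union> {{s}, c - {s}}"
  have ne: "c - {s} \<noteq> {}"
    using assms(3) s by auto
  have "splits_block \<B> ?B'"
    unfolding splits_block_def using c s ne
    by (intro bexI[of _ c] exI[of _ "{s}"] exI[of _ "c - {s}"]) auto
  moreover have "partition_on (wa_states M) ?B'"
  proof (rule partition_onI)
    show "\<Union>?B' = wa_states M"
      using partition_onD1[OF part] c s by auto
    show "disjnt d e" if "d \<in> ?B'" "e \<in> ?B'" "d \<noteq> e" for d e
    proof -
      have out: "d \<inter> c = {}" if "d \<in> \<B> - {c}" for d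
        using that c part unfolding partition_on_def disjoint_def by blast
      have "d \<inter> e = {}" if "d \<in> \<B>" "e \<in> \<B>" "d \<noteq> e" for d e
        using that part unfolding partition_on_def disjoint_def by blast
      with out that s show ?thesis
        unfolding disjnt_def by blast
    qed
    show "{} \<notin> ?B'"
      using ne partition_onD3[OF part] by auto
  qed
  moreover have "\<exists>e\<in>\<B>. d \<subseteq> e" if "d \<in> ?B'" for d
    using that c s by auto
  ultimately have "splits_block \<B> ?B' \<and> consistent M ?B'"
    using cons unfolding consistent_def by (meson subsetD)
  then show ?thesis by blast
qed

text \<open>A block contained in another block equals it, being nonempty. Hence a counterexample
  keeps its weight, and its violation, at the start of its refinement loop.\<close>

lemma refined_paths_self:
  assumes cons: "consistent M \<B>" and C: "\<And>\<gamma>. \<gamma> \<in> C \<Longrightarrow> is_path (quot M \<B>) \<gamma>"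
  shows "refined_paths M \<B> C = C"
proof -
  have sub: "d = c" if "d \<in> \<B>" "c \<in> \<B>" "d \<subseteq> c" for c d
  proof -
    have "d \<noteq> {}"
      using cons that unfolding consistent_def partition_on_def by blast
    with that have "d \<inter> c \<noteq> {}" by blast
    with that cons show ?thesis
      unfolding consistent_def partition_on_def disjoint_def by meson
  qed
  have eq: "\<rho> = \<gamma>" if \<gamma>: "is_path (quot M \<B>) \<gamma>" and \<rho>: "is_path (quot M \<B>) \<rho>"
    and rel: "path_rel (\<subseteq>) \<rho> \<gamma>" for \<rho> \<gamma>
  proof -
    obtain d l c g where *: "\<rho> = (d, l)" "\<gamma> = (c, g)" by fastforce
    have B: "d \<in> \<B>" "c \<in> \<B>" "snd ` set l \<subseteq> \<B>" "snd ` set g \<subseteq> \<B>"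
      using is_path_quot_states[of M \<B> d l] is_path_quot_states[of M \<B> c g] \<gamma> \<rho> * by auto
    have "list_all2 (rel_prod (=) (\<subseteq>)) l g"
      using rel * by (simp add: path_rel_def)
    then have "l = g"
      using B(3,4) by (induction rule: list_all2_induct) (auto dest: sub)
    moreover have "d = c"
      using rel * B sub by (simp add: path_rel_def)
    ultimately show ?thesis
      by (simp add: *)
  qed
  have "path_rel (\<subseteq>) \<gamma> \<gamma>" for \<gamma> :: "('a set, 'b) path"
    by (cases \<gamma>) (auto simp: path_rel_def rel_prod_conv intro!: list.rel_refl_strong)
  with C eq show ?thesis
    unfolding refined_paths_def by blast
qed

text \<open>The maximum and the sum in a quotient weight have one term each, so wrapping states in
  singletons is a weight-preserving bijection. At this finest partition a spurious counterexample no
  longer violates the bound.\<close>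

lemma total_weight_refined_paths_singletons:
  assumes part: "partition_on (wa_states M) \<B>" and sing: "\<And>c. c \<in> \<B> \<Longrightarrow> \<exists>s. c = {s}"
  shows "total_weight (quot M \<B>) (refined_paths M \<B> C) = total_weight M (realization M C)"
proof -
  define f :: "('a, 'b) path \<Rightarrow> ('a set, 'b) path"
    where "f = map_prod (\<lambda>s. {s}) (map (map_prod id (\<lambda>s. {s})))"
  have inj: "inj f"
    unfolding f_def by (intro prod.inj_map list.inj_map) (auto simp: inj_def)
  have mem: "{s} \<in> \<B> \<longleftrightarrow> s \<in> wa_states M" for s
    using part sing unfolding partition_on_def by (metis UnionE UnionI insertI1 singletonD)
  have w: "wa_weight (quot M \<B>) {s} a {t} = wa_weight M s a t" for s a t
    by (simp add: quot_def)
  have st: "wa_states (quot M \<B>) = \<B>"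
    by (simp add: quot_def)
  have f_simps: "f (s, []) = ({s}, [])" "f (s, (a, t) # l) = ({s}, (a, {t}) # snd (f (t, l)))"
    "({s}, snd (f (s, l))) = f (s, l)" for s a t l
    by (simp_all add: f_def)
  have path: "is_path (quot M \<B>) (f (s, l)) \<longleftrightarrow> is_path M (s, l)" for s l
  proof (induction l arbitrary: s)
    case (Cons x l)
    then show ?case by (cases x) (simp add: f_simps st mem w)
  qed (simp add: f_simps st mem)
  have weight: "path_weight (quot M \<B>) (f (s, l)) = path_weight M (s, l)" for s l
  proof (induction l arbitrary: s)
    case (Cons x l)
    then show ?case by (cases x) (simp add: f_simps w)
  qed (simp add: f_simps)
  have rel: "path_rel (\<subseteq>) (f \<rho>) \<gamma> \<longleftrightarrow> path_rel (\<in>) \<rho> \<gamma>" for \<rho> \<gamma>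
  proof -
    have "rel_prod (=) (\<subseteq>) (map_prod id (\<lambda>s. {s}) x) = rel_prod (=) (\<in>) x" for x :: "'b \<times> 'a"
      by (cases x) (auto simp: fun_eq_iff rel_prod_conv)
    then show ?thesis
      by (cases \<rho>; cases \<gamma>) (simp add: path_rel_def f_def list_all2_map1)
  qed
  have surj: "\<gamma> \<in> range f" if \<gamma>: "is_path (quot M \<B>) \<gamma>" for \<gamma>
  proof -
    obtain c g where g: "\<gamma> = (c, g)" by fastforce
    have B: "c \<in> \<B>" "snd ` set g \<subseteq> \<B>"
      using is_path_quot_states[of M \<B> c g] \<gamma> g by auto
    have el: "{the_elem d} = d" if "d \<in> \<B>" for d
      using sing[OF that] by auto
    have "map (map_prod id (\<lambda>s. {s})) (map (map_prod id the_elem) g) = g"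
      unfolding map_map using B(2) by (intro map_idI) (auto simp: el)
    then have "f (the_elem c, map (map_prod id the_elem) g) = \<gamma>"
      using B(1) by (simp add: f_def g el)
    then show ?thesis by blast
  qed
  have "refined_paths M \<B> C = f ` realization M C"
  proof (intro set_eqI iffI)
    fix \<gamma> assume "\<gamma> \<in> refined_paths M \<B> C"
    moreover from this obtain s l where "\<gamma> = f (s, l)"
      using surj unfolding refined_paths_def by fastforce
    ultimately show "\<gamma> \<in> f ` realization M C"
      by (auto simp: refined_paths_def realization_def path rel)
  next
    fix \<gamma> assume "\<gamma> \<in> f ` realization M C"
    then show "\<gamma> \<in> refined_paths M \<B> C"
      by (auto simp: refined_paths_def realization_def path rel)
  qed
  then show ?thesis
    unfolding total_weight_def
    by (auto simp: sum.reindex[OF inj_on_subset[OF inj subset_UNIV]] weight intro!: sum.cong)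
qed

section \<open>Invariant, termination and progress of the procedure\<close>

fun config_inv :: "('s, 'a, 'o, 'p) wa \<Rightarrow> 'p pctl \<Rightarrow> ('s, 'a) config \<Rightarrow> bool" where
  "config_inv M \<phi> (Check \<B>) \<longleftrightarrow> consistent M \<B>"
| "config_inv M \<phi> (Refine C \<B>) \<longleftrightarrow>
     consistent M \<B> \<and> \<not> violates \<phi> (total_weight M (realization M C))"
| "config_inv M \<phi> (Holds \<B>) \<longleftrightarrow> consistent M \<B> \<and> wa_sat (quot M \<B>) \<phi>"
| "config_inv M \<phi> (Fails \<B> C) \<longleftrightarrow> consistent M \<B> \<and> counterexample (quot M \<B>) \<phi> C \<and>
     violates \<phi> (total_weight M (realization M C))"

text \<open>Spuriousness is established on entering a loop and concerns only \<open>C\<close> and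
  the concrete automaton, so it survives every split; consistency after a split is a premise of that
  step.\<close>

lemma config_inv_step: "cegar_step M \<phi> x y \<Longrightarrow> config_inv M \<phi> x \<Longrightarrow> config_inv M \<phi> y"
  by (induction rule: cegar_step.induct) auto

lemma config_inv_start: "config_inv M \<phi> (cegar_start M)"
  by (simp add: cegar_start_def consistent_coarsest)

lemma config_inv_reachable:
  assumes "cegar_reachable M \<phi> x"
  shows "config_inv M \<phi> x"
  using assms unfolding cegar_reachable_def
  by (induction rule: rtranclp_induct) (auto intro: config_inv_start config_inv_step)

text \<open>
  The weights 0, 1, 2 ensure that a split, which lowers the first summand by 3, outweighs any
  change of phase. Entering a refinement lands in the phase 0, since a fresh counterexample still
  violates the bound over its own partition; hence no refinement returns without a split.
\<close>

fun config_measure ::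
  "('s::finite, 'a, 'o, 'p) wa \<Rightarrow> 'p pctl \<Rightarrow> ('s, 'a) config \<Rightarrow> nat" where
  "config_measure M \<phi> (Check \<B>) = 3 * (CARD('s) - card \<B>) + 1"
| "config_measure M \<phi> (Refine C \<B>) = 3 * (CARD('s) - card \<B>) +
     (if violates \<phi> (total_weight (quot M \<B>) (refined_paths M \<B> C)) then 0 else 2)"
| "config_measure M \<phi> (Holds \<B>) = 0"
| "config_measure M \<phi> (Fails \<B> C) = 0"

lemma counterexample_is_path: "counterexample M \<phi> C \<Longrightarrow> \<gamma> \<in> C \<Longrightarrow> is_path M \<gamma>"
  by (cases \<phi>) (auto simp: until_paths_def)

lemma counterexample_violates: "counterexample M \<phi> C \<Longrightarrow> violates \<phi> (total_weight M C)"
  by (cases \<phi>) auto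

lemma config_measure_step:
  fixes M :: "('s::finite, 'a::finite, 'o, 'p) wa"
  assumes "cegar_step M \<phi> x y" and "config_inv M \<phi> x"
  shows "config_measure M \<phi> y < config_measure M \<phi> x"
  using assms
proof (induction rule: cegar_step.induct)
  case (spurious \<B> C)
  then have "refined_paths M \<B> C = C"
    by (intro refined_paths_self) (auto intro: counterexample_is_path)
  with spurious show ?case
    by (simp add: counterexample_violates)
next
  case (split \<B> C \<B>')
  then have "card \<B>' = Suc (card \<B>)" "card \<B>' \<le> CARD('s)"
    using card_splits_block card_partition_le by (auto simp: consistent_def)
  \<comment> \<open>The bound on \<open>card \<B>'\<close> ensures that the truncated subtraction
    has not already reached 0.\<close>
  then have "CARD('s) - card \<B> = Suc (CARD('s) - card \<B>')"
    by simp
  with split show ?case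
    by simp
qed auto

text \<open>An infinite execution would keep the invariant and make \<open>config_measure\<close>
  descend forever.\<close>

lemma cegar_terminates:
  fixes M :: "('s::finite, 'a::finite, 'o, 'p) wa"
  shows "\<nexists>f. f (0::nat) = cegar_start M \<and> (\<forall>i. cegar_step M \<phi> (f i) (f (Suc i)))"
proof
  assume "\<exists>f. f (0::nat) = cegar_start M \<and> (\<forall>i. cegar_step M \<phi> (f i) (f (Suc i)))"
  then obtain f where f0: "f (0::nat) = cegar_start M"
    and step: "\<And>i. cegar_step M \<phi> (f i) (f (Suc i))"
    by blast
  have inv: "config_inv M \<phi> (f i)" for i
    by (induction i) (auto simp: f0 config_inv_start intro: config_inv_step[OF step])
  have "(f (Suc i), f i) \<in> Wellfounded.measure (config_measure M \<phi>)" for i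
    using config_measure_step[OF step inv] by simp
  then show False
    using wf_iff_no_infinite_down_chain[of "Wellfounded.measure (config_measure M \<phi>)"] by blast
qed

text \<open>All minimal paths under a violating adversary serve as the counterexample, as they are
  finitely many. So \<open>Check\<close> never gets stuck.\<close>

lemma counterexample_exists:
  fixes M :: "('s::finite, 'a::finite, 'o, 'p) wa"
  assumes "\<not> wa_sat M \<phi>"
  shows "\<exists>C. counterexample M \<phi> C"
proof (cases \<phi>)
  case (Prob c p \<psi>)
  with assms obtain \<sigma> where "\<not> meets_bound c (total_weight M (until_paths M \<sigma> \<psi>)) p"
    by auto
  then have "counterexample M \<phi> (until_paths M \<sigma> \<psi>)"
    by (auto simp: Prob finite_until_paths)
  then show ?thesis by blast
qed

text \<open>Excludes deadlocks, so that termination means that a report has been made.\<close>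

lemma cegar_progress:
  fixes M :: "('s::finite, 'a::finite, 'o, 'p) wa"
  assumes inv: "config_inv M \<phi> x" and stuck: "\<nexists>y. cegar_step M \<phi> x y"
  shows "(\<exists>\<B>. x = Holds \<B>) \<or> (\<exists>\<B> C. x = Fails \<B> C)"
proof (cases x)
  case (Check \<B>)
  then show ?thesis
    using stuck counterexample_exists[of "quot M \<B>" \<phi>] by (metis cegar_step.intros(1-3))
next
  case (Refine C \<B>)
  then have cons: "consistent M \<B>" and real: "\<not> violates \<phi> (total_weight M (realization M C))"
    using inv by auto
  have viol: "violates \<phi> (total_weight (quot M \<B>) (refined_paths M \<B> C))"
    using stuck Refine cegar_step.refined by metis
  \<comment> \<open>One weight violates the bound and the other does not. Over singletons they would
    agree, so some block can still be split.\<close>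
  then have "total_weight (quot M \<B>) (refined_paths M \<B> C) \<noteq> total_weight M (realization M C)"
    using real by metis
  then obtain c where "c \<in> \<B>" "\<nexists>s. c = {s}"
    using total_weight_refined_paths_singletons cons unfolding consistent_def by metis
  from exists_split[OF cons this] obtain \<B>' where "splits_block \<B> \<B>'" "consistent M \<B>'"
    by blast
  with cegar_step.split[OF viol] stuck Refine show ?thesis
    by blast
qed auto

section \<open>Soundness of the two reports\<close>

lemma realization_subset_until_paths:
  fixes M :: "('s::finite, 'a::finite, 'o, 'p) wa"
  assumes cons: "consistent M \<B>" and init: "wa_init M \<in> wa_states M"
    and uniq: "\<And>s. wa_obs M s = wa_obs M (wa_init M) \<Longrightarrow> s = wa_init M"
    and C: "C \<subseteq> until_paths (quot M \<B>) \<sigma> \<psi>"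
  shows "realization M C \<subseteq> until_paths M \<sigma> \<psi>"
proof
  fix \<rho> assume "\<rho> \<in> realization M C"
  then obtain \<gamma> where path: "is_path M \<rho>" and \<gamma>: "\<gamma> \<in> until_paths (quot M \<B>) \<sigma> \<psi>"
    and rel: "path_rel (\<in>) \<rho> \<gamma>"
    using C unfolding realization_def by blast
  \<comment> \<open>A realization may start anywhere in the initial block; equal observations there
    and \<open>uniq\<close> leave only the initial state.\<close>
  have "fst \<gamma> = block \<B> (wa_init M)"
    using \<gamma> by (simp add: until_paths_def wa_init_quot[OF cons])
  then have "fst \<rho> \<in> block \<B> (wa_init M)"
    using rel by (cases \<rho>; cases \<gamma>) (simp add: path_rel_def)
  then have "wa_obs M (fst \<rho>) = wa_obs M (wa_init M)"
    using cons block_in[OF cons init] in_block[OF cons init] unfolding consistent_def by blast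
  with uniq show "\<rho> \<in> until_paths M \<sigma> \<psi>"
    by (intro until_paths_quot_realize[OF cons \<gamma> path rel])
qed

lemma meets_bound_mono: "meets_bound c y p \<Longrightarrow> x \<le> y \<Longrightarrow> meets_bound c x p"
  by (cases c) auto

text \<open>Under each adversary the abstract weight is the larger one, and both comparisons are
  upper bounds.\<close>

lemma wa_sat_quot_sound:
  fixes M :: "('s::finite, 'a::finite, 'o, 'p) wa"
  assumes "consistent M \<B>" and "\<And>s a t. 0 \<le> wa_weight M s a t" and "wa_sat (quot M \<B>) \<phi>"
  shows "wa_sat M \<phi>"
proof (cases \<phi>)
  case (Prob c p \<psi>)
  with assms(3) show ?thesis
    by (auto intro: meets_bound_mono total_weight_le_quot[OF assms(1,2)])
qed

text \<open>All realizations follow the single adversary of the abstract counterexample. With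
  nonnegative weights, an upper bound violated by part of its until paths is violated by all of
  them.\<close>

lemma realization_refutes:
  fixes M :: "('s::finite, 'a::finite, 'o, 'p) wa"
  assumes cons: "consistent M \<B>" and nonneg: "\<And>s a t. 0 \<le> wa_weight M s a t"
    and init: "wa_init M \<in> wa_states M"
    and uniq: "\<And>s. wa_obs M s = wa_obs M (wa_init M) \<Longrightarrow> s = wa_init M"
    and C: "counterexample (quot M \<B>) \<phi> C"
    and viol: "violates \<phi> (total_weight M (realization M C))"
  shows "\<not> wa_sat M \<phi>"
proof (cases \<phi>)
  case (Prob c p \<psi>)
  with C obtain \<sigma> where "C \<subseteq> until_paths (quot M \<B>) \<sigma> \<psi>"
    by auto
  from realization_subset_until_paths[OF cons init uniq this]
  have "total_weight M (realization M C) \<le> total_weight M (until_paths M \<sigma> \<psi>)"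
    unfolding total_weight_def
    by (intro sum_mono2 finite_until_paths) (auto intro: path_weight_nonneg[OF nonneg])
  with viol Prob show ?thesis
    by (auto intro: meets_bound_mono)
qed

theorem theorem2:
  fixes P :: "('s::finite, 'a::finite, 'z::finite, 'p) pomdp"
    and M :: "(('s \<times> 'z) option, 'a, 'z option, 'p) wa"
    and c :: cmp and p :: real and \<phi>1 \<phi>2 :: "'p form" and k :: nat
    and \<phi> :: "'p pctl"
  assumes "M = wa_of P"
    and "\<phi> = Prob c p (Until \<phi>1 k \<phi>2)"
  shows
    "(\<nexists>f. f (0::nat) = cegar_start M \<and> (\<forall>i. cegar_step M \<phi> (f i) (f (Suc i)))) \<and>
     (\<forall>x. cegar_reachable M \<phi> x \<and> (\<nexists>y. cegar_step M \<phi> x y) \<longrightarrow>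
        (\<exists>\<B>. x = Holds \<B>) \<or> (\<exists>\<B> C. x = Fails \<B> C)) \<and>
     (\<forall>\<B>. cegar_reachable M \<phi> (Holds \<B>) \<longrightarrow> p_sat P \<phi>) \<and>
     (\<forall>\<B> C. cegar_reachable M \<phi> (Fails \<B> C) \<longrightarrow> \<not> p_sat P \<phi>)"
proof -
  have nonneg: "0 \<le> wa_weight M s a t" for s a t
    by (simp add: assms(1) wa_of_weight_nonneg)
  have init: "wa_init M \<in> wa_states M"
    by (simp add: assms(1) wa_of_def)
  \<comment> \<open>\<open>map_option snd\<close> yields \<open>None\<close> only at
    \<open>None\<close>: the observation \<open>init\<close> belongs to the initial state
    alone.\<close>
  have uniq: "wa_obs M s = wa_obs M (wa_init M) \<Longrightarrow> s = wa_init M" for s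
    by (simp add: assms(1) wa_of_def)
  have "wa_sat M \<phi>" if "cegar_reachable M \<phi> (Holds \<B>)" for \<B>
    using config_inv_reachable[OF that] by (auto intro: wa_sat_quot_sound nonneg)
  moreover have "\<not> wa_sat M \<phi>" if "cegar_reachable M \<phi> (Fails \<B> C)" for \<B> C
    using config_inv_reachable[OF that] realization_refutes[OF _ nonneg init uniq] by auto
  moreover have "(\<exists>\<B>. x = Holds \<B>) \<or> (\<exists>\<B> C. x = Fails \<B> C)"
    if "cegar_reachable M \<phi> x" "\<nexists>y. cegar_step M \<phi> x y" for x
    using cegar_progress[OF config_inv_reachable[OF that(1)] that(2)] .
  ultimately show ?thesis
    unfolding p_sat_iff_wa_sat assms(1)[symmetric] using cegar_terminates[of M \<phi>] by blast
qed

end
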